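(* Let $\mu$ be a probability measure on $\Omega$ satisfying (A1), (A2) and (A3). Let $\mathcal{A}$ be the event that the number of infinite clusters (infinite $0$-clusters and infinite $1$-clusters together) is nonzero and finite. Then $\mu(\mathcal{A})=0$.
   Context: Let $G$ be the square grid with vertex set $\mathbb{Z}^2$, where $(m,n)$ and $(m',n')$ are adjacent iff $|m-m'|+|n-n'|=1$. Each face of $G$ is a unit square; the face whose lower-left corner is $(m,n)$ is called black if $m+n$ is even and white if $m+n$ is odd. Let $\Omega\subset\{0,1\}^{\mathbb{Z}^2}$ be the set of configurations $\omega$ such that, for every black face, the states of its four vertices listed clockwise starting from the lower-left corner form one of the words $0000,1111,0011,1100,0110,1001$. A cluster of $\omega$ is a maximal set of vertices which is connected in $G$ and on which $\omega$ is constant; it is a $0$-cluster or $1$-cluster according to that state, and infinite if it has infinitely many vertices. Assumptions on a probability measure $\mu$ on $\Omega$: (A1) $\mu$ is invariant under the translations of $\mathbb{Z}^2$ by the subgroup generated by $(1,1)$ and $(1,-1)$; (A2) $\mu$ is $2\mathbb{Z}\times 2\mathbb{Z}$-ergodic, i.e. every event invariant under translations by $2\mathbb{Z}\times2\mathbb{Z}$ has probability $0$ or $1$; (A3) $\mu$ is invariant under the map $\theta(\omega)(v)=1-\omega(v)$. *)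

theory Defs
  imports "HOL-Probability.Probability"
begin

type_synonym vertex = "int \<times> int"
type_synonym config = "vertex \<Rightarrow> nat"

definition adj :: "vertex \<Rightarrow> vertex \<Rightarrow> bool" where
  "adj u v \<longleftrightarrow> \<bar>fst u - fst v\<bar> + \<bar>snd u - snd v\<bar> = 1"

text \<open>Face with lower-left corner (m,n) is black iff m+n is even.\<close>
definition black :: "vertex \<Rightarrow> bool" where
  "black f \<longleftrightarrow> even (fst f + snd f)"

definition face_word :: "config \<Rightarrow> vertex \<Rightarrow> nat list" where
  "face_word \<omega> f = (let m = fst f; n = snd f in
     [\<omega> (m, n), \<omega> (m, n + 1), \<omega> (m + 1, n + 1), \<omega> (m + 1, n)])"

definition Omega :: "config set" where
  "Omega = {\<omega>. (\<forall>v. \<omega> v \<in> {0, 1}) \<and>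
     (\<forall>f. black f \<longrightarrow> face_word \<omega> f \<in>
        {[0,0,0,0], [1,1,1,1], [0,0,1,1], [1,1,0,0], [0,1,1,0], [1,0,0,1]})}"

inductive path_in :: "vertex set \<Rightarrow> vertex \<Rightarrow> vertex \<Rightarrow> bool" for S where
  refl: "x \<in> S \<Longrightarrow> path_in S x x"
| step: "path_in S x y \<Longrightarrow> adj y z \<Longrightarrow> z \<in> S \<Longrightarrow> path_in S x z"

definition G_connected :: "vertex set \<Rightarrow> bool" where
  "G_connected S \<longleftrightarrow> (\<forall>x\<in>S. \<forall>y\<in>S. path_in S x y)"

definition constant_on_set :: "config \<Rightarrow> vertex set \<Rightarrow> bool" where
  "constant_on_set \<omega> S \<longleftrightarrow> (\<exists>c. \<forall>v\<in>S. \<omega> v = c)"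

definition is_cluster :: "config \<Rightarrow> vertex set \<Rightarrow> bool" where
  "is_cluster \<omega> C \<longleftrightarrow> C \<noteq> {} \<and> G_connected C \<and> constant_on_set \<omega> C \<and>
     (\<forall>D. C \<subseteq> D \<and> G_connected D \<and> constant_on_set \<omega> D \<longrightarrow> D = C)"

definition infinite_clusters :: "config \<Rightarrow> vertex set set" where
  "infinite_clusters \<omega> = {C. is_cluster \<omega> C \<and> infinite C}"

definition event_A :: "config set" where
  "event_A = {\<omega> \<in> Omega. infinite_clusters \<omega> \<noteq> {} \<and> finite (infinite_clusters \<omega>)}"

definition shift :: "vertex \<Rightarrow> config \<Rightarrow> config" where
  "shift a \<omega> = (\<lambda>v. \<omega> (fst v + fst a, snd v + snd a))"

definition flip :: "config \<Rightarrow> config" where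
  "flip \<omega> = (\<lambda>v. 1 - \<omega> v)"

definition diag_lattice :: "vertex set" where
  "diag_lattice = {(a + b, a - b) | a b. True}"

definition even_lattice :: "vertex set" where
  "even_lattice = {(2 * a, 2 * b) | a b. True}"

definition config_space :: "config measure" where
  "config_space = restrict_space (PiM UNIV (\<lambda>_. count_space {0, 1})) Omega"

end

(* Merge clusters across the contours of one of the two dual lattices, and separately across those
   of the other lattice. Let H be the bipartite graph whose vertices are the infinite merged clusters
   of the two kinds and whose edges are the infinite clusters, each joining the two merged clusters
   containing it. H is a tree as soon as it has an edge: every cluster is a bridge because its
   boundary splits into two closed parts, and a finite cluster cannot separate two infinite sets.
   So if there are N infinite clusters, 0 < N < infinity, then H has N + 1 vertices. By ergodicity
   all the counts are almost surely constant; N is even by (A3), and N + 1 is even because the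
   translation by (1,1) exchanges the two lattices. *)
theory Submission
  imports Defs
begin

section \<open>Classes of a relation\<close>

definition cls :: "('a \<Rightarrow> 'a \<Rightarrow> bool) \<Rightarrow> 'a \<Rightarrow> 'a set" where
  "cls R v = {u. R\<^sup>*\<^sup>* v u}"

text \<open>The filter \<open>Q\<close> is tested on a representative; in the applications it is
  constant on classes, being either trivially true or a prescribed state.\<close>

definition inf_cls :: "('a \<Rightarrow> 'a \<Rightarrow> bool) \<Rightarrow> ('a \<Rightarrow> bool) \<Rightarrow> 'a set set" where
  "inf_cls R Q = {cls R v | v. Q v \<and> infinite (cls R v)}"

text \<open>Finiteness is required separately because \<open>card\<close> is 0 on infinite sets, so
  that the count 0 is not confused with an infinite count.\<close>

definition has_card :: "'a set \<Rightarrow> nat \<Rightarrow> bool" where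
  "has_card S n \<longleftrightarrow> finite S \<and> card S = n"

lemma cls_self [simp]: "v \<in> cls R v"
  by (simp add: cls_def)

lemma cls_eq_iff:
  assumes "symp R"
  shows "cls R u = cls R v \<longleftrightarrow> R\<^sup>*\<^sup>* u v"
  using symp_rtranclp[OF assms] unfolding cls_def
  by (auto dest: sympD intro: rtranclp_trans)

lemma cls_eqI:
  assumes "symp R" "u \<in> cls R v"
  shows "cls R u = cls R v"
  using assms cls_eq_iff[OF assms(1), of v u] by (simp add: cls_def)

lemma cls_mono:
  assumes "\<And>u v. R u v \<Longrightarrow> R' u v"
  shows "cls R v \<subseteq> cls R' v"
proof -
  have "R \<le> R'" using assms by blast
  then show ?thesis unfolding cls_def using rtranclp_mono by blast
qed

lemma rtranclp_invariant:
  assumes "R\<^sup>*\<^sup>* u v" "\<And>u v. R u v \<Longrightarrow> f u = f v"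
  shows "f u = f v"
  using assms by (induction) auto

lemma cls_image:
  assumes "bij g" "\<And>u v. R' u v \<longleftrightarrow> R (g u) (g v)"
  shows "cls R (g v) = g ` cls R' v"
proof -
  have 1: "R\<^sup>*\<^sup>* (g u) (g v)" if "R'\<^sup>*\<^sup>* u v" for u v
    using that by (induction) (auto simp: assms(2) intro: rtranclp.rtrancl_into_rtrancl)
  have 2: "R'\<^sup>*\<^sup>* u (inv g w)" if "R\<^sup>*\<^sup>* (g u) w" for u w
    using that
  proof (induction)
    case base
    then show ?case using assms(1) by (simp add: bij_is_inj)
  next
    case (step y z)
    then have "R' (inv g y) (inv g z)"
      using assms by (simp add: bij_is_surj surj_f_inv_f)
    with step show ?case by (meson rtranclp.rtrancl_into_rtrancl)
  qed
  show ?thesis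
  proof (intro set_eqI iffI)
    fix w assume "w \<in> cls R (g v)"
    then have "inv g w \<in> cls R' v" using 2 by (simp add: cls_def)
    moreover have "w = g (inv g w)" using assms(1) by (simp add: bij_is_surj surj_f_inv_f)
    ultimately show "w \<in> g ` cls R' v" by blast
  qed (use 1 in \<open>auto simp: cls_def\<close>)
qed

text \<open>Transport along a graph isomorphism \<open>g\<close>, which later is a translation of
  the grid.\<close>

lemma has_card_inf_cls_image:
  assumes "bij g" "\<And>u v. R' u v \<longleftrightarrow> R (g u) (g v)" "\<And>v. Q' v \<longleftrightarrow> Q (g v)"
  shows "has_card (inf_cls R' Q') n \<longleftrightarrow> has_card (inf_cls R Q) n"
proof -
  have inj: "inj g" using assms(1) by (rule bij_is_inj)
  have "inf_cls R Q = (`) g ` inf_cls R' Q'"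
  proof (intro set_eqI iffI)
    fix C assume "C \<in> inf_cls R Q"
    then obtain v where v: "C = cls R v" "Q v" "infinite C" by (auto simp: inf_cls_def)
    obtain u where u: "v = g u" using assms(1) by (metis bij_is_surj surjE)
    have "C = g ` cls R' u" using v u cls_image[of g R' R, OF assms(1,2)] by simp
    then show "C \<in> (`) g ` inf_cls R' Q'"
      using v u assms(3) unfolding inf_cls_def by (auto dest: finite_imageI)
  next
    fix C assume "C \<in> (`) g ` inf_cls R' Q'"
    then obtain u where u: "C = g ` cls R' u" "Q' u" "infinite (cls R' u)"
      by (auto simp: inf_cls_def)
    have "C = cls R (g u)" using u cls_image[of g R' R, OF assms(1,2)] by simp
    moreover have "infinite C" using u inj by (simp add: finite_image_iff inj_on_subset)
    ultimately show "C \<in> inf_cls R Q"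
      using u assms(3) unfolding inf_cls_def by auto
  qed
  moreover have "inj_on ((`) g) (inf_cls R' Q')"
    using inj by (simp add: inj_on_def inj_image_eq_iff)
  ultimately show ?thesis
    unfolding has_card_def by (simp add: card_image finite_image_iff)
qed

text \<open>Quantifying over lists of representatives instead of sets of classes leaves only
  countable quantifiers when the vertices are countable; this is what makes the count
  measurable.\<close>

lemma has_card_inf_cls_iff:
  assumes "symp R"
  shows "has_card (inf_cls R Q) n \<longleftrightarrow>
    (\<exists>xs. length xs = n \<and> (\<forall>i<n. \<forall>j<n. i \<noteq> j \<longrightarrow> \<not> R\<^sup>*\<^sup>* (xs ! i) (xs ! j)) \<and>
      (\<forall>i<n. Q (xs ! i) \<and> infinite (cls R (xs ! i))) \<and>
      (\<forall>v. Q v \<and> infinite (cls R v) \<longrightarrow> (\<exists>i<n. R\<^sup>*\<^sup>* (xs ! i) v)))"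
    (is "_ \<longleftrightarrow> (\<exists>xs. ?P xs)")
proof
  assume "has_card (inf_cls R Q) n"
  then obtain Cs where Cs: "set Cs = inf_cls R Q" "distinct Cs" "length Cs = n"
    unfolding has_card_def using finite_distinct_list distinct_card by metis
  have "\<forall>i<n. \<exists>v. Cs ! i = cls R v \<and> Q v \<and> infinite (cls R v)"
    using Cs nth_mem[of _ Cs] unfolding inf_cls_def by auto
  then obtain f where f: "\<And>i. i < n \<Longrightarrow> Cs ! i = cls R (f i) \<and> Q (f i) \<and> infinite (cls R (f i))"
    by metis
  have "?P (map f [0..<n])"
  proof (intro conjI allI impI)
    fix i j assume "i < n" "j < n" "i \<noteq> j"
    then show "\<not> R\<^sup>*\<^sup>* (map f [0..<n] ! i) (map f [0..<n] ! j)"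
      using f Cs cls_eq_iff[OF assms] by (simp add: nth_eq_iff_index_eq) (metis nth_eq_iff_index_eq)
  next
    fix v assume "Q v \<and> infinite (cls R v)"
    then have "cls R v \<in> set Cs" using Cs by (auto simp: inf_cls_def)
    then obtain i where "i < n" "Cs ! i = cls R v" using Cs by (metis in_set_conv_nth)
    then show "\<exists>i<n. R\<^sup>*\<^sup>* (map f [0..<n] ! i) v"
      using f cls_eq_iff[OF assms] by (intro exI[of _ i]) auto
  qed (use f in auto)
  then show "\<exists>xs. ?P xs" by blast
next
  assume "\<exists>xs. ?P xs"
  then obtain xs where xs: "?P xs" by blast
  have "inf_cls R Q = set (map (cls R) xs)"
  proof (intro set_eqI iffI)
    fix C assume "C \<in> inf_cls R Q"
    then obtain v where v: "C = cls R v" "Q v" "infinite (cls R v)" by (auto simp: inf_cls_def)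
    then obtain i where i: "i < n" "R\<^sup>*\<^sup>* (xs ! i) v" using xs by blast
    then have "C = cls R (xs ! i)" using v cls_eq_iff[OF assms] by blast
    then show "C \<in> set (map (cls R) xs)" using i xs by auto
  next
    fix C assume "C \<in> set (map (cls R) xs)"
    then obtain i where "i < n" "C = cls R (xs ! i)" using xs by (auto simp: in_set_conv_nth)
    then show "C \<in> inf_cls R Q" using xs by (auto simp: inf_cls_def)
  qed
  moreover have "distinct (map (cls R) xs)"
    using xs cls_eq_iff[OF assms] by (auto simp: distinct_conv_nth)
  ultimately show "has_card (inf_cls R Q) n"
    unfolding has_card_def using xs by (metis List.finite_set distinct_card length_map)
qed

section \<open>Measurability of the number of infinite classes\<close>

lemma pred_rtranclp:
  fixes R :: "'b \<Rightarrow> 'a::countable \<Rightarrow> 'a \<Rightarrow> bool"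
  assumes [measurable]: "\<And>u v. Measurable.pred M (\<lambda>x. R x u v)"
  shows "Measurable.pred M (\<lambda>x. (R x)\<^sup>*\<^sup>* u v)"
proof -
  have [measurable]: "Measurable.pred M (\<lambda>x. (R x ^^ n) u v)" for n v
    by (induction n arbitrary: v) (simp_all add: OO_def)
  show ?thesis unfolding rtranclp_is_Sup_relpowp by simp
qed

text \<open>Lists stand in for finite sets: over a countable type there are only countably many of
  them, which keeps the condition measurable.\<close>

lemma infinite_iff_notin_list: "infinite S \<longleftrightarrow> (\<forall>xs. \<exists>w. w \<in> S \<and> w \<notin> set xs)"
proof
  assume "infinite S"
  then show "\<forall>xs. \<exists>w. w \<in> S \<and> w \<notin> set xs"
    by (meson List.finite_set finite_subset subsetI)
next
  assume "\<forall>xs. \<exists>w. w \<in> S \<and> w \<notin> set xs"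
  then show "infinite S" using finite_list by metis
qed

lemma pred_has_card_inf_cls:
  fixes R :: "'b \<Rightarrow> 'a::countable \<Rightarrow> 'a \<Rightarrow> bool"
  assumes "\<And>x. symp (R x)"
    and [measurable]: "\<And>u v. Measurable.pred M (\<lambda>x. R x u v)" "\<And>v. Measurable.pred M (\<lambda>x. Q x v)"
  shows "Measurable.pred M (\<lambda>x. has_card (inf_cls (R x) (Q x)) n)"
proof -
  note [measurable] = pred_rtranclp[OF assms(2)]
  have [measurable]: "Measurable.pred M (\<lambda>x. infinite (cls (R x) v))" for v
    unfolding infinite_iff_notin_list cls_def mem_Collect_eq by measurable
  show ?thesis
    unfolding has_card_inf_cls_iff[OF assms(1)] by measurable
qed

section \<open>Trees\<close>

text \<open>In a rooted tree every node other than the root is the far end of exactly one edge. Here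
  \<open>f e\<close> and \<open>g e\<close> are the ends of \<open>e\<close>, and
  \<open>lam e\<close> is the side of the bridge \<open>e\<close> away from the root
  \<open>r\<close>. The hypothesis \<open>conn\<close> expresses connectedness: an edge-closed set
  that contains a node reaches \<open>r\<close>.\<close>

lemma bij_betw_far_end:
  fixes E :: "'e set" and f g :: "'e \<Rightarrow> 'n" and lam :: "'e \<Rightarrow> 'n \<Rightarrow> bool"
  assumes cut: "\<And>e e'. e \<in> E \<Longrightarrow> e' \<in> E \<Longrightarrow> lam e (f e') \<noteq> lam e (g e') \<longleftrightarrow> e' = e"
    and root: "\<And>e. e \<in> E \<Longrightarrow> \<not> lam e r"
    and conn: "\<And>X x. (\<And>e. e \<in> E \<Longrightarrow> f e \<in> X \<longleftrightarrow> g e \<in> X) \<Longrightarrow> x \<in> f ` E \<union> g ` E \<Longrightarrow> x \<in> X \<Longrightarrow> r \<in> X"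
  shows "bij_betw (\<lambda>e. if lam e (f e) then f e else g e) E (f ` E \<union> g ` E - {r})"
proof -
  define c where "c = (\<lambda>e. if lam e (f e) then f e else g e)"
  have c: "lam e (c e)" if "e \<in> E" for e
    using cut[OF that that] by (auto simp: c_def)
  have c_end: "c e = f e \<or> c e = g e" for e by (auto simp: c_def)
  have "inj_on c E"
  proof (rule inj_onI, rule ccontr)
    fix e e' assume ee: "e \<in> E" "e' \<in> E" "c e = c e'" "e \<noteq> e'"
    \<comment> \<open>If \<open>e\<close> and \<open>e'\<close> share their far end, no edge leaves
      the union of their far sides: \<open>lam e'\<close> cuts no edge but \<open>e'\<close>, so the
      near end of \<open>e\<close> lies on the same side of \<open>e'\<close> as the common far end,
      and conversely.\<close>
    define X where "X = {n. lam e n \<or> lam e' n}"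
    have "f d \<in> X \<longleftrightarrow> g d \<in> X" if "d \<in> E" for d
      using ee that cut[of e d] cut[of e' d] c[of e] c[of e'] c_end[of e] c_end[of e']
      unfolding X_def mem_Collect_eq by metis
    moreover have "c e \<in> f ` E \<union> g ` E" "c e \<in> X" using ee c c_end[of e] by (auto simp: X_def)
    ultimately have "r \<in> X" by (rule conn)
    then show False using root ee by (auto simp: X_def)
  qed
  moreover have "c ` E = f ` E \<union> g ` E - {r}"
  proof (intro set_eqI iffI)
    fix n assume "n \<in> c ` E"
    then show "n \<in> f ` E \<union> g ` E - {r}" using c root c_end by blast
  next
    fix n assume n: "n \<in> f ` E \<union> g ` E - {r}"
    show "n \<in> c ` E"
    proof (rule ccontr)
      assume no: "n \<notin> c ` E"
      \<comment> \<open>If \<open>n\<close> is no far end, it is the near end of every edge at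
        \<open>n\<close>. Then \<open>n\<close> together with the far sides of these edges is
        edge-closed and so contains the root, which lies on no far side.\<close>
      define X where "X = {x. x = n \<or> (\<exists>e\<in>E. (f e = n \<or> g e = n) \<and> lam e x)}"
      have "f d \<in> X \<longleftrightarrow> g d \<in> X" if d: "d \<in> E" for d
      proof (cases "f d = n \<or> g d = n")
        case True
        have "c d \<noteq> n" using no d by blast
        then have "c d \<in> X" using True d c by (auto simp: X_def)
        moreover have "n \<in> X" by (simp add: X_def)
        ultimately show ?thesis using True c_end[of d] \<open>c d \<noteq> n\<close> by auto
      next
        case False
        then show ?thesis unfolding X_def using cut d by blast
      qed
      moreover have "n \<in> f ` E \<union> g ` E" "n \<in> X" using n by (auto simp: X_def)
      ultimately have "r \<in> X" by (rule conn)
      then show False using n root by (auto simp: X_def)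
    qed
  qed
  ultimately show ?thesis unfolding bij_betw_def c_def by blast
qed

section \<open>The square grid\<close>

lemma adj_sym: "adj u v \<longleftrightarrow> adj v u"
  by (auto simp: adj_def abs_minus_commute)

lemma adj_simps [simp]: "adj (x, y) (x + 1, y)" "adj (x, y) (x, y + 1)"
  by (auto simp: adj_def)

lemma adj_cases:
  assumes "adj u v"
  obtains m n where "u = (m, n)" "v = (m + 1, n)" | m n where "u = (m + 1, n)" "v = (m, n)"
    | m n where "u = (m, n)" "v = (m, n + 1)" | m n where "u = (m, n + 1)" "v = (m, n)"
proof -
  obtain a b c d where uv: "u = (a, b)" "v = (c, d)" by (metis surj_pair)
  have "\<bar>a - c\<bar> + \<bar>b - d\<bar> = 1" using assms by (simp add: uv adj_def)
  then consider "c = a + 1" "d = b" | "a = c + 1" "d = b" | "c = a" "d = b + 1" | "c = a" "b = d + 1"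
    by linarith
  then show thesis using that uv by cases auto
qed

lemma ray_constant:
  fixes P :: "int \<Rightarrow> 'a"
  assumes "\<And>k. k > n \<Longrightarrow> P k = P (k + 1)" "i > n"
  shows "P i = P (n + 1)"
  using assms(2)
proof (induction i rule: int_gr_induct)
  case (step i)
  then show ?case using assms(1)[of i] by simp
qed simp

lemma line_constant:
  fixes P :: "int \<Rightarrow> 'a"
  assumes "\<And>k. P k = P (k + 1)"
  shows "P i = P j"
proof -
  have "P i = P (min i j - 1 + 1)" by (rule ray_constant) (use assms in auto)
  moreover have "P j = P (min i j - 1 + 1)" by (rule ray_constant) (use assms in auto)
  ultimately show ?thesis by simp
qed

section \<open>Connectedness of the complement of a box\<close>

definition off_box :: "int \<Rightarrow> vertex \<Rightarrow> bool" where
  "off_box n v \<longleftrightarrow> fst v > n \<or> fst v < - n \<or> snd v > n \<or> snd v < - n"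

text \<open>A point off the box has its whole column or its whole row off the box. Following it and
  then the row or column of the corner \<open>(n + 1, n + 1)\<close> leads to that corner.\<close>

lemma off_box_constant:
  assumes inv: "\<And>u v. adj u v \<Longrightarrow> off_box n u \<Longrightarrow> off_box n v \<Longrightarrow> P u = P v"
    and "off_box n u" "off_box n v"
  shows "P u = P v"
proof -
  have *: "P u = P (n + 1, n + 1)" if u: "off_box n u" for u
  proof -
    obtain x y where xy: "u = (x, y)" by (metis surj_pair)
    have col: "P (x, y) = P (x, n + 1)" if "x > n \<or> x < - n" for x y
      by (rule line_constant[of "\<lambda>y. P (x, y)"], rule inv) (use that in \<open>auto simp: off_box_def\<close>)
    have row: "P (x, y) = P (n + 1, y)" if "y > n \<or> y < - n" for x y
      by (rule line_constant[of "\<lambda>x. P (x, y)"], rule inv) (use that in \<open>auto simp: off_box_def\<close>)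
    show ?thesis
    proof (cases "x > n \<or> x < - n")
      case True
      then show ?thesis using col[of x y] row[of "n + 1" x] xy by simp
    next
      case False
      then have "y > n \<or> y < - n" using u xy by (simp add: off_box_def)
      then show ?thesis using row[of y x] col[of "n + 1" y] xy by simp
    qed
  qed
  show ?thesis using *[OF assms(2)] *[OF assms(3)] by simp
qed

lemma grid_constant:
  assumes "\<And>u v. adj u v \<Longrightarrow> P u = P v"
  shows "P u = P v"
  \<comment> \<open>For \<open>n = -1\<close> the box is empty and \<open>off_box\<close> holds
    everywhere.\<close>
  by (rule off_box_constant[of "-1"]) (use assms in \<open>auto simp: off_box_def\<close>)

lemma finite_avoids_off_box:
  fixes F :: "vertex set"
  assumes "finite F"
  obtains n where "\<And>v. off_box n v \<Longrightarrow> v \<notin> F" "\<And>S. infinite S \<Longrightarrow> \<exists>v\<in>S. off_box n v"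
proof -
  obtain n where n: "\<forall>k \<in> (\<lambda>v. \<bar>fst v\<bar>) ` F \<union> (\<lambda>v. \<bar>snd v\<bar>) ` F. k \<le> n"
    using assms by (meson bdd_above.E bdd_above_finite finite_UnI finite_imageI)
  show thesis
  proof
    show "v \<notin> F" if "off_box n v" for v
      using n that by (force simp: off_box_def)
  next
    fix S :: "vertex set" assume "infinite S"
    show "\<exists>v\<in>S. off_box n v"
    proof (rule ccontr)
      assume "\<not> ?thesis"
      then have "S \<subseteq> {-n..n} \<times> {-n..n}" by (fastforce simp: off_box_def)
      then show False using \<open>infinite S\<close> finite_subset by blast
    qed
  qed
qed

section \<open>Primitives of closed forms mod 2\<close>

lemma int_primitive: "\<exists>F. F 0 = (c::bool) \<and> (\<forall>m::int. F (m + 1) \<noteq> F m \<longleftrightarrow> g m)"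
proof -
  define N where "N a b = card {k. a \<le> k \<and> k < b \<and> g k}" for a b :: int
  \<comment> \<open>\<open>F m\<close> is \<open>c\<close> plus the number of jumps between 0 and
    \<open>m\<close>, mod 2. For either sign of \<open>m\<close> one of the two counts is over an
    empty interval, so the sum is the wanted number.\<close>
  define F where "F m = (c \<noteq> odd (N 0 m + N m 0))" for m
  have fin: "finite {k. a \<le> k \<and> k < b \<and> g k}" for a b :: int
    by (rule finite_subset[of _ "{a..b}"]) auto
  have empty: "N a b = 0" if "b \<le> a" for a b
  proof -
    have "{k. a \<le> k \<and> k < b \<and> g k} = {}" using that by auto
    then show ?thesis unfolding N_def by (simp only: card.empty)
  qed
  have last: "N a (b + 1) = of_bool (g b) + N a b" if "a \<le> b" for a b
  proof -
    have "{k. a \<le> k \<and> k < b + 1 \<and> g k} = (if g b then {b} else {}) \<union> {k. a \<le> k \<and> k < b \<and> g k}"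
      using that by (auto simp: order_le_less)
    then show ?thesis unfolding N_def using fin[of a b] by simp
  qed
  have first: "N a b = of_bool (g a) + N (a + 1) b" if "a < b" for a b
  proof -
    have "{k. a \<le> k \<and> k < b \<and> g k} = (if g a then {a} else {}) \<union> {k. a + 1 \<le> k \<and> k < b \<and> g k}"
      using that by (auto simp: order_le_less)
    then show ?thesis unfolding N_def using fin[of "a + 1" b] by simp
  qed
  have "F (m + 1) \<noteq> F m \<longleftrightarrow> g m" for m
  proof (cases "m \<ge> 0")
    case True
    then show ?thesis unfolding F_def using last[of 0 m] empty[of 0 m] empty[of 0 "m + 1"]
      by (cases "g m") auto
  next
    case False
    then show ?thesis unfolding F_def using first[of m 0] empty[of m 0] empty[of "m + 1" 0]
      by (cases "g m") auto
  qed
  moreover have "F 0 = c" by (simp add: F_def empty)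
  ultimately show ?thesis by blast
qed

text \<open>A discrete Poincare lemma mod 2: \<open>h m n\<close> and \<open>v m n\<close> are
  values on the edges from \<open>(m, n)\<close> to the right and upwards, and \<open>closed\<close>
  says that they sum to 0 around each face. The primitive comes from integrating along row 0 and
  then along the columns.\<close>

lemma grid_primitive:
  fixes h v :: "int \<Rightarrow> int \<Rightarrow> bool"
  assumes closed: "\<And>m n. (h m n \<noteq> h m (n + 1)) \<longleftrightarrow> (v m n \<noteq> v (m + 1) n)"
  shows "\<exists>f :: int \<times> int \<Rightarrow> bool. (\<forall>m n. f (m + 1, n) \<noteq> f (m, n) \<longleftrightarrow> h m n) \<and>
    (\<forall>m n. f (m, n + 1) \<noteq> f (m, n) \<longleftrightarrow> v m n)"
proof -
  obtain A :: "int \<Rightarrow> bool" where A: "\<And>m. A (m + 1) \<noteq> A m \<longleftrightarrow> h m 0"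
    using int_primitive[of True "\<lambda>m. h m 0"] by blast
  have "\<forall>m. \<exists>F. F 0 = A m \<and> (\<forall>n. F (n + 1) \<noteq> F n \<longleftrightarrow> v m n)"
    using int_primitive by blast
  then obtain B where B: "\<And>m. B m 0 = A m" "\<And>m n. B m (n + 1) \<noteq> B m n \<longleftrightarrow> v m n"
    by metis
  \<comment> \<open>Closedness makes the truth value of this equivalence the same in all rows; in
    row 0 it holds by the choice of \<open>A\<close>.\<close>
  have "(B (m + 1) n \<noteq> B m n \<longleftrightarrow> h m n) = (B (m + 1) 0 \<noteq> B m 0 \<longleftrightarrow> h m 0)" for m n
    by (rule line_constant[of "\<lambda>n. (B (m + 1) n \<noteq> B m n \<longleftrightarrow> h m n)"])
      (use B(2)[of m] B(2)[of "m + 1"] closed[of m] in blast)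
  then have "B (m + 1) n \<noteq> B m n \<longleftrightarrow> h m n" for m n using A B(1) by blast
  then show ?thesis using B(2) by (intro exI[of _ "\<lambda>(m, n). B m n"]) simp
qed


section \<open>The tree of merged clusters\<close>

text \<open>Every edge of the grid borders exactly one white face \<open>(m, n)\<close>; it is an odd edge
  if \<open>m\<close> is odd. Such faces and the remaining white faces span two dual square lattices, and a
  contour of a configuration in \<open>Omega\<close> stays within one of them.\<close>

definition odd_edge :: "vertex \<Rightarrow> vertex \<Rightarrow> bool" where
  "odd_edge u v \<longleftrightarrow>
    (if snd u = snd v then odd (min (fst u) (fst v)) else even (min (snd u) (snd v)))"

definition same_step :: "config \<Rightarrow> vertex \<Rightarrow> vertex \<Rightarrow> bool" where
  "same_step \<omega> u v \<longleftrightarrow> adj u v \<and> \<omega> u = \<omega> v"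

text \<open>Edges of kind \<open>b\<close> can always be crossed, so the classes are the merged
  clusters, bounded only by contours of the other kind.\<close>

definition merge_step :: "bool \<Rightarrow> config \<Rightarrow> vertex \<Rightarrow> vertex \<Rightarrow> bool" where
  "merge_step b \<omega> u v \<longleftrightarrow> adj u v \<and> (\<omega> u = \<omega> v \<or> odd_edge u v = b)"

lemma odd_edge_sym: "odd_edge u v \<longleftrightarrow> odd_edge v u"
  by (auto simp: odd_edge_def min.commute)

lemma odd_edge_simps [simp]:
  "odd_edge (m, n) (m + 1, n) \<longleftrightarrow> odd m" "odd_edge (m + 1, n) (m, n) \<longleftrightarrow> odd m"
  "odd_edge (m, n) (m, n + 1) \<longleftrightarrow> even n" "odd_edge (m, n + 1) (m, n) \<longleftrightarrow> even n"
  by (auto simp: odd_edge_def min_def)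

lemma symp_same_step: "symp (same_step \<omega>)"
  unfolding symp_def same_step_def using adj_sym by metis

lemma symp_merge_step: "symp (merge_step b \<omega>)"
  unfolding symp_def merge_step_def using adj_sym odd_edge_sym by metis

lemma same_step_imp_merge_step: "same_step \<omega> u v \<Longrightarrow> merge_step b \<omega> u v"
  by (auto simp: same_step_def merge_step_def)

lemma adj_imp_merge_step: "adj u v \<Longrightarrow> merge_step False \<omega> u v \<or> merge_step True \<omega> u v"
  by (auto simp: merge_step_def)

text \<open>Each allowed word lets a contour cross a black face only straight, through two opposite
  edges. Opposite edges are of the same kind, so the contour stays in one dual lattice.\<close>

lemma Omega_black_face:
  assumes "\<omega> \<in> Omega" "even (m + n)"
  shows "\<omega> (m, n) = \<omega> (m, n + 1) \<and> \<omega> (m + 1, n) = \<omega> (m + 1, n + 1) \<or>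
         \<omega> (m, n) = \<omega> (m + 1, n) \<and> \<omega> (m, n + 1) = \<omega> (m + 1, n + 1)"
proof -
  have "black (m, n)" using assms(2) by (simp add: black_def)
  then have "face_word \<omega> (m, n) \<in>
        {[0,0,0,0], [1,1,1,1], [0,0,1,1], [1,1,0,0], [0,1,1,0], [1,0,0,1]}"
    using assms(1) unfolding Omega_def by blast
  then show ?thesis by (auto simp: face_word_def Let_def)
qed

text \<open>The boundary of a cluster consists of an odd and an even part, both closed; integrating the
  odd part over the simply connected grid gives \<open>s\<close>.\<close>

lemma cluster_cut:
  assumes "\<omega> \<in> Omega"
  obtains s t where "\<And>u v. merge_step False \<omega> u v \<Longrightarrow> s u = s v"
    "\<And>u v. merge_step True \<omega> u v \<Longrightarrow> t u = t v"
    "\<And>v. s v \<noteq> t v \<longleftrightarrow> v \<in> cls (same_step \<omega>) x" "\<not> s r"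
proof -
  define ind where "ind v \<longleftrightarrow> v \<in> cls (same_step \<omega>) x" for v
  have ind: "ind u = ind v" if "adj u v" "\<omega> u = \<omega> v" for u v
  proof -
    have "same_step \<omega> u v" "same_step \<omega> v u" using that by (auto simp: same_step_def adj_sym)
    then show ?thesis unfolding ind_def cls_def by (auto intro: rtranclp.rtrancl_into_rtrancl)
  qed
  have face: "ind (m, n) = ind (m, n + 1) \<and> ind (m + 1, n) = ind (m + 1, n + 1) \<or>
      ind (m, n) = ind (m + 1, n) \<and> ind (m, n + 1) = ind (m + 1, n + 1)" if "even (m + n)" for m n
    using Omega_black_face[OF assms that] ind[of "(m, n)" "(m, n + 1)"] ind[of "(m, n)" "(m + 1, n)"]
      ind[of "(m, n + 1)" "(m + 1, n + 1)"] ind[of "(m + 1, n)" "(m + 1, n + 1)"]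
    by auto
  define h where "h m n \<longleftrightarrow> odd m \<and> ind (m, n) \<noteq> ind (m + 1, n)" for m n
  define v where "v m n \<longleftrightarrow> even n \<and> ind (m, n) \<noteq> ind (m, n + 1)" for m n
  \<comment> \<open>\<open>h\<close> and \<open>v\<close> mark the odd edges on the boundary of the
    cluster. The four edges of a white face are of one kind, so either all its boundary edges count,
    an even number, or none does. At a black face, by \<open>face\<close>, the boundary crosses no
    edge or a pair of opposite edges, which are of the same kind.\<close>
  have closed: "(h m n \<noteq> h m (n + 1)) \<longleftrightarrow> (v m n \<noteq> v (m + 1) n)" for m n
    using face[of m n] unfolding h_def v_def by (cases "odd m"; cases "odd n") auto
  obtain f :: "vertex \<Rightarrow> bool" where f: "(\<forall>m n. f (m + 1, n) \<noteq> f (m, n) \<longleftrightarrow> h m n) \<and>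
      (\<forall>m n. f (m, n + 1) \<noteq> f (m, n) \<longleftrightarrow> v m n)"
    using grid_primitive[of h v, OF closed] ..
  have f_adj: "f u \<noteq> f v \<longleftrightarrow> odd_edge u v \<and> ind u \<noteq> ind v" if "adj u v" for u v
  proof (cases rule: adj_cases[OF that])
    case (1 m n)
    then show ?thesis using f[THEN conjunct1, rule_format, of m n] h_def[of m n] by auto
  next
    case (2 m n)
    then show ?thesis using f[THEN conjunct1, rule_format, of m n] h_def[of m n] by auto
  next
    case (3 m n)
    then show ?thesis using f[THEN conjunct2, rule_format, of m n] v_def[of m n] by auto
  next
    case (4 m n)
    then show ?thesis using f[THEN conjunct2, rule_format, of m n] v_def[of m n] by auto
  qed
  \<comment> \<open>The primitive is normalised to be false at \<open>r\<close>. Then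
    \<open>s\<close> jumps exactly across the odd boundary edges and \<open>t\<close> exactly across
    the even ones, so each is constant on the merged clusters of one kind.\<close>
  define s where "s v \<longleftrightarrow> f v \<noteq> f r" for v
  define t where "t v \<longleftrightarrow> s v \<noteq> ind v" for v
  have "s u = s v" if "merge_step False \<omega> u v" for u v
    using that f_adj[of u v] ind[of u v] by (auto simp: merge_step_def s_def)
  moreover have "t u = t v" if "merge_step True \<omega> u v" for u v
    using that f_adj[of u v] ind[of u v] by (auto simp: merge_step_def s_def t_def)
  ultimately show thesis by (rule that) (auto simp: s_def t_def ind_def)
qed

text \<open>The tree is first built on all clusters, finite ones included, and rooted at a merged
  cluster \<open>S r\<close>. The bijection from clusters to their far ends is then restricted to
  the infinite ones, and the root accounts for the 1.\<close>

lemma card_merged_clusters: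
  assumes \<omega>: "\<omega> \<in> Omega"
    and N: "has_card (inf_cls (same_step \<omega>) (\<lambda>_. True)) N" "N > 0"
  obtains a b where "has_card (inf_cls (merge_step False \<omega>) (\<lambda>_. True)) a"
    "has_card (inf_cls (merge_step True \<omega>) (\<lambda>_. True)) b" "a + b = N + 1"
proof -
  define W S T where "W = cls (same_step \<omega>)" and "S = cls (merge_step False \<omega>)"
    and "T = cls (merge_step True \<omega>)"
  have self: "v \<in> W v" "v \<in> S v" "v \<in> T v" for v by (auto simp: W_def S_def T_def)
  have sub: "W v \<subseteq> S v" "W v \<subseteq> T v" for v
    unfolding W_def S_def T_def by (simp_all add: cls_mono same_step_imp_merge_step)
  have eq: "u \<in> W v \<Longrightarrow> W u = W v" "u \<in> S v \<Longrightarrow> S u = S v" "u \<in> T v \<Longrightarrow> T u = T v" for u v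
    unfolding W_def S_def T_def by (simp_all add: cls_eqI symp_same_step symp_merge_step)
  define IW IS IT where "IW = {W v | v. infinite (W v)}" and "IS = {S v | v. infinite (S v)}"
    and "IT = {T v | v. infinite (T v)}"
  have I: "IW = inf_cls (same_step \<omega>) (\<lambda>_. True)" "IS = inf_cls (merge_step False \<omega>) (\<lambda>_. True)"
    "IT = inf_cls (merge_step True \<omega>) (\<lambda>_. True)"
    by (auto simp: inf_cls_def IW_def IS_def IT_def W_def S_def T_def)
  have finIW: "finite IW" and cardIW: "card IW = N" using N by (auto simp: I has_card_def)
  then have "IW \<noteq> {}" using N(2) by auto
  \<comment> \<open>Placing \<open>r\<close> in an infinite cluster makes the root
    \<open>S r\<close> infinite.\<close>
  then obtain r where r: "infinite (W r)" by (auto simp: IW_def)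
  have infr: "infinite (S r)" using r sub finite_subset by blast
  define cut where "cut x s t \<longleftrightarrow> (\<forall>u v. merge_step False \<omega> u v \<longrightarrow> s u = s v) \<and>
      (\<forall>u v. merge_step True \<omega> u v \<longrightarrow> t u = t v) \<and> (\<forall>v. s v \<noteq> t v \<longleftrightarrow> v \<in> W x) \<and> \<not> s r"
    for x s t
  have "\<exists>s t. cut x s t" for x
    by (rule cluster_cut[OF \<omega>, of x r]) (unfold cut_def W_def, blast)
  then obtain s t where "\<And>x. cut x (s x) (t x)" by metis
  then have s: "\<And>x u v. merge_step False \<omega> u v \<Longrightarrow> s x u = s x v"
    and t: "\<And>x u v. merge_step True \<omega> u v \<Longrightarrow> t x u = t x v"
    and st: "\<And>x v. s x v \<noteq> t x v \<longleftrightarrow> v \<in> W x" and sr: "\<And>x. \<not> s x r"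
    unfolding cut_def by blast+
  have sS: "s x u = s x v" if "u \<in> S v" for x u v
    using rtranclp_invariant[of "merge_step False \<omega>" v u "s x"] that s by (auto simp: S_def cls_def)
  have tT: "t x u = t x v" if "u \<in> T v" for x u v
    using rtranclp_invariant[of "merge_step True \<omega>" v u "t x"] that t by (auto simp: T_def cls_def)

  \<comment> \<open>The cut functions \<open>s\<close> and \<open>t\<close> are indexed by vertices;
    one chosen vertex per cluster lets clusters index them.\<close>
  define rep where "rep C = (SOME v. C = W v)" for C
  have rep: "W (rep (W v)) = W v" for v unfolding rep_def by (metis (mono_tags) someI)
  \<comment> \<open>The sum type keeps merged clusters of different kinds apart even when they
    coincide as sets.\<close>
  define f :: "vertex set \<Rightarrow> vertex set + vertex set" where "f C = Inl (S (rep C))" for C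
  define g :: "vertex set \<Rightarrow> vertex set + vertex set" where "g C = Inr (T (rep C))" for C
  have fW: "f (W v) = Inl (S v)" and gW: "g (W v) = Inr (T v)" for v
    using eq(2,3)[of "rep (W v)" v] self(1)[of "rep (W v)"] rep[of v] sub[of v]
    by (auto simp: f_def g_def)
  \<comment> \<open>The side of the bridge \<open>C\<close> away from the root. It can be read at
    any vertex of the merged cluster, because \<open>s\<close> is constant on each
    \<open>S v\<close> and \<open>t\<close> on each \<open>T v\<close>.\<close>
  define lam where "lam C n = (case n of Inl A \<Rightarrow> \<exists>v\<in>A. s (rep C) v | Inr B \<Rightarrow> \<exists>v\<in>B. t (rep C) v)"
    for C and n :: "vertex set + vertex set"
  have lamS: "lam C (Inl (S v)) = s (rep C) v" and lamT: "lam C (Inr (T v)) = t (rep C) v" for C v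
    unfolding lam_def sum.case using sS tT self(2,3) by blast+
  define c where "c = (\<lambda>C. if lam C (f C) then f C else g C)"
  have nodes: "f ` range W \<union> g ` range W = Inl ` range S \<union> Inr ` range T"
    by (simp add: image_image fW gW image_Un)
  have "bij_betw c (range W) (f ` range W \<union> g ` range W - {Inl (S r)})"
    unfolding c_def
  proof (rule bij_betw_far_end)
    fix C D assume "C \<in> range W" "D \<in> range W"
    then obtain v w where vw: "C = W v" "D = W w" by blast
    \<comment> \<open>The ends of \<open>D\<close> lie on different sides of \<open>C\<close> iff
      \<open>s\<close> and \<open>t\<close> differ at \<open>w\<close>, that is, iff
      \<open>w\<close> lies in the cluster \<open>C\<close>.\<close>
    have "lam C (f D) \<noteq> lam C (g D) \<longleftrightarrow> w \<in> W (rep C)"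
      using st[of "rep (W v)" w] by (simp add: vw fW gW lamS lamT)
    also have "\<dots> \<longleftrightarrow> D = C" using vw rep eq(1) self(1) by metis
    finally show "lam C (f D) \<noteq> lam C (g D) \<longleftrightarrow> D = C" .
  next
    show "\<not> lam C (Inl (S r))" for C by (simp add: lamS sr)
  next
    fix X x assume X: "\<And>C. C \<in> range W \<Longrightarrow> (f C \<in> X) = (g C \<in> X)"
      and x: "x \<in> f ` range W \<union> g ` range W" "x \<in> X"
    have X': "Inl (S v) \<in> X \<longleftrightarrow> Inr (T v) \<in> X" for v using X[of "W v"] by (simp add: fW gW)
    \<comment> \<open>Adjacent vertices share a merged cluster of at least one kind, and
      \<open>X'\<close> passes between the kinds; so connectedness of the grid gives that of the
      graph.\<close>
    have "(Inl (S u) \<in> X) = (Inl (S v) \<in> X)" for u v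
    proof (rule grid_constant)
      fix u v assume "adj u v"
      then have "v \<in> S u \<or> v \<in> T u"
        using adj_imp_merge_step[of u v \<omega>] by (auto simp: S_def T_def cls_def)
      then have "S v = S u \<or> T v = T u" using eq by blast
      then show "(Inl (S u) \<in> X) = (Inl (S v) \<in> X)" using X' by metis
    qed
    moreover have "\<exists>v. Inl (S v) \<in> X" using x X' unfolding nodes by auto
    ultimately show "Inl (S r) \<in> X" by blast
  qed
  then have bij: "bij_betw c (range W) (Inl ` range S \<union> Inr ` range T - {Inl (S r)})"
    unfolding nodes .

  \<comment> \<open>A finite cluster has no infinite far end: off a large box \<open>s\<close> and
    \<open>t\<close> agree, so \<open>s\<close> is constant there, every adjacency being a merging
    step of some kind. But \<open>s\<close> would be true somewhere off the box by the infinite far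
    end, and false on the infinite root.\<close>
  have inf_end: "infinite (W v)" if "c (W v) = Inl (S w) \<and> infinite (S w) \<and> S w \<noteq> S r \<or>
      c (W v) = Inr (T w) \<and> infinite (T w)" for v w
  proof
    assume fin: "finite (W v)"
    define x where "x = rep (W v)"
    obtain n where n: "\<And>u. off_box n u \<Longrightarrow> u \<notin> W v" "\<And>A. infinite A \<Longrightarrow> \<exists>u\<in>A. off_box n u"
      using finite_avoids_off_box[OF fin] by metis
    have Wx: "W x = W v" unfolding x_def by (rule rep)
    have far: "lam (W v) (c (W v))"
      using st[of x v] self(1)[of v] unfolding Wx by (auto simp: c_def fW gW lamS lamT x_def)
    have off: "s x u = t x u" if "off_box n u" for u using st[of x u] n(1)[OF that] Wx by blast
    have "\<exists>p. off_box n p \<and> s x p"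
      using that
    proof (elim disjE conjE)
      assume c: "c (W v) = Inl (S w)" and "infinite (S w)"
      then obtain u where "u \<in> S w" "off_box n u" using n(2) by blast
      moreover have "s x w" using far c by (simp add: lamS x_def)
      ultimately show ?thesis using sS by blast
    next
      assume c: "c (W v) = Inr (T w)" and "infinite (T w)"
      then obtain u where "u \<in> T w" "off_box n u" using n(2) by blast
      moreover have "t x w" using far c by (simp add: lamT x_def)
      ultimately show ?thesis using tT off by blast
    qed
    then obtain p where p: "off_box n p" "s x p" by blast
    obtain q where q: "q \<in> S r" "off_box n q" using n(2) infr by blast
    have "s x p = s x q"
    proof (rule off_box_constant[OF _ p(1) q(2)])
      fix a b assume "adj a b" "off_box n a" "off_box n b"
      then show "s x a = s x b" using adj_imp_merge_step[of a b \<omega>] s t off by metis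
    qed
    then show False using p(2) q(1) sS sr by blast
  qed
  \<comment> \<open>Both ends of an infinite cluster contain it and are infinite; conversely an
    infinite node other than the root comes from an infinite cluster by
    \<open>inf_end\<close>.\<close>
  have bij': "bij_betw c IW (Inl ` IS \<union> Inr ` IT - {Inl (S r)})"
  proof (rule bij_betw_subset[OF bij])
    show "IW \<subseteq> range W" by (auto simp: IW_def)
    show "c ` IW = Inl ` IS \<union> Inr ` IT - {Inl (S r)}"
    proof (intro set_eqI iffI)
      fix y assume "y \<in> c ` IW"
      then obtain v where v: "y = c (W v)" "infinite (W v)" by (auto simp: IW_def)
      have "infinite (S v)" "infinite (T v)" using v(2) sub[of v] by (auto dest: finite_subset)
      then have "S v \<in> IS" "T v \<in> IT" unfolding IS_def IT_def by blast+
      then have "y \<in> Inl ` IS \<union> Inr ` IT" using v(1) by (simp add: c_def fW gW)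
      moreover have "y \<noteq> Inl (S r)" using bij v(1) by (auto simp: bij_betw_def)
      ultimately show "y \<in> Inl ` IS \<union> Inr ` IT - {Inl (S r)}" by blast
    next
      fix y assume y: "y \<in> Inl ` IS \<union> Inr ` IT - {Inl (S r)}"
      then have "y \<in> Inl ` range S \<union> Inr ` range T - {Inl (S r)}" by (auto simp: IS_def IT_def)
      then have "y \<in> c ` range W" using bij unfolding bij_betw_def by blast
      then obtain v where v: "y = c (W v)" by blast
      have "\<exists>w. c (W v) = Inl (S w) \<and> infinite (S w) \<and> S w \<noteq> S r \<or>
          c (W v) = Inr (T w) \<and> infinite (T w)"
        using y unfolding v IS_def IT_def by (elim DiffE UnE imageE CollectE exE conjE) auto
      then have "infinite (W v)" using inf_end by blast
      then have "W v \<in> IW" unfolding IW_def by blast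
      then show "y \<in> c ` IW" using v by simp
    qed
  qed
  have card: "card (Inl ` IS \<union> Inr ` IT - {Inl (S r)}) = N"
    using bij_betw_same_card[OF bij'] cardIW by simp
  have fin: "finite (Inl ` IS \<union> Inr ` IT - {Inl (S r)})"
    using bij_betw_finite[OF bij'] finIW by simp
  have fin': "finite (Inl ` IS \<union> Inr ` IT)" using fin by (simp add: finite_Diff2)
  then have finS: "finite IS" and finT: "finite IT" by (simp_all add: finite_image_iff)
  have "S r \<in> IS" using infr unfolding IS_def by blast
  then have "Inl (S r) \<in> Inl ` IS \<union> Inr ` IT" by simp
  then have "card (Inl ` IS \<union> Inr ` IT) = N + 1"
    using card fin' by (metis Suc_eq_plus1 card_Suc_Diff1)
  moreover have "card (Inl ` IS \<union> Inr ` IT) = card IS + card IT"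
    using finS finT by (subst card_Un_disjoint) (auto simp: card_image)
  ultimately show thesis
    using that[of "card IS" "card IT"] finS finT by (simp add: has_card_def I)
qed

section \<open>Infinite clusters\<close>

lemma path_in_imp_cls:
  assumes "path_in D u v" "constant_on_set \<omega> D"
  shows "u \<in> D \<and> v \<in> D \<and> v \<in> cls (same_step \<omega>) u"
  using assms(1)
proof induction
  case (step x y z)
  then have "same_step \<omega> y z" using assms(2) by (auto simp: same_step_def constant_on_set_def)
  then show ?case using step by (auto simp: cls_def intro: rtranclp.rtrancl_into_rtrancl)
qed simp

lemma cls_same_step_value: "v \<in> cls (same_step \<omega>) u \<Longrightarrow> \<omega> v = \<omega> u"
  using rtranclp_invariant[of "same_step \<omega>" u v \<omega>] by (auto simp: cls_def same_step_def)

lemma G_connected_cls: "G_connected (cls (same_step \<omega>) u)"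
  unfolding G_connected_def
proof (intro ballI)
  fix x y assume x: "x \<in> cls (same_step \<omega>) u" and y: "y \<in> cls (same_step \<omega>) u"
  have eq: "cls (same_step \<omega>) x = cls (same_step \<omega>) u" using cls_eqI[OF symp_same_step x] .
  have "y \<in> cls (same_step \<omega>) x" using y eq by simp
  then have "(same_step \<omega>)\<^sup>*\<^sup>* x y" by (simp add: cls_def)
  then show "path_in (cls (same_step \<omega>) u) x y"
  proof induction
    case base
    show ?case using x by (rule path_in.refl)
  next
    case (step y z)
    then have "z \<in> cls (same_step \<omega>) x" by (simp add: cls_def)
    then have "z \<in> cls (same_step \<omega>) u" using eq by simp
    moreover have "adj y z" using step.hyps(2) by (simp add: same_step_def)
    ultimately show ?case using step.IH by (blast intro: path_in.step)
  qed
qed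

lemma constant_on_cls: "constant_on_set \<omega> (cls (same_step \<omega>) u)"
  unfolding constant_on_set_def using cls_same_step_value by blast

lemma subset_cls:
  assumes "G_connected D" "constant_on_set \<omega> D" "u \<in> D"
  shows "D \<subseteq> cls (same_step \<omega>) u"
  using assms path_in_imp_cls[of D u _ \<omega>] unfolding G_connected_def by blast

text \<open>A class is itself connected and constant, and any connected constant set lies in the
  class of each of its vertices, so maximality singles out the classes.\<close>

lemma is_cluster_iff: "is_cluster \<omega> C \<longleftrightarrow> (\<exists>v. C = cls (same_step \<omega>) v)"
proof
  assume C: "is_cluster \<omega> C"
  then obtain v where v: "v \<in> C" by (auto simp: is_cluster_def)
  then have "C \<subseteq> cls (same_step \<omega>) v" using C subset_cls by (simp add: is_cluster_def)
  then show "\<exists>v. C = cls (same_step \<omega>) v"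
    using C G_connected_cls constant_on_cls unfolding is_cluster_def by metis
next
  assume "\<exists>v. C = cls (same_step \<omega>) v"
  then obtain v where v: "C = cls (same_step \<omega>) v" by blast
  have "D = C" if "C \<subseteq> D" "G_connected D" "constant_on_set \<omega> D" for D
    using subset_cls[OF that(2,3), of v] that(1) cls_self[of v "same_step \<omega>"] v by blast
  moreover have "C \<noteq> {}" unfolding v using cls_self by (metis emptyE)
  moreover have "G_connected C" unfolding v by (rule G_connected_cls)
  moreover have "constant_on_set \<omega> C" unfolding v by (rule constant_on_cls)
  ultimately show "is_cluster \<omega> C" unfolding is_cluster_def by simp
qed

lemma infinite_clusters_eq: "infinite_clusters \<omega> = inf_cls (same_step \<omega>) (\<lambda>_. True)"
  by (auto simp: infinite_clusters_def inf_cls_def is_cluster_iff)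

section \<open>The profile of a configuration\<close>

text \<open>Fixing all four finite counts at once gives countably many measurable events, to which
  ergodicity and the symmetries apply one by one.\<close>

definition profile :: "nat \<Rightarrow> nat \<Rightarrow> nat \<Rightarrow> nat \<Rightarrow> config set" where
  "profile k l a b = {\<omega> \<in> Omega.
     has_card (inf_cls (same_step \<omega>) (\<lambda>v. \<omega> v = 0)) k \<and>
     has_card (inf_cls (same_step \<omega>) (\<lambda>v. \<omega> v = 1)) l \<and>
     has_card (inf_cls (merge_step False \<omega>) (\<lambda>_. True)) a \<and>
     has_card (inf_cls (merge_step True \<omega>) (\<lambda>_. True)) b}"

lemma profile_Omega: "profile k l a b \<subseteq> Omega"
  by (auto simp: profile_def)

lemma vimage_Omega:
  assumes "\<And>\<omega>. \<omega> \<in> Omega \<Longrightarrow> F \<omega> \<in> P \<longleftrightarrow> \<omega> \<in> Q" "Q \<subseteq> Omega"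
  shows "F -` P \<inter> Omega = Q"
  using assms by auto

lemma profile_unique:
  "\<omega> \<in> profile k l a b \<Longrightarrow> \<omega> \<in> profile k' l' a' b' \<Longrightarrow> k = k' \<and> l = l' \<and> a = a' \<and> b = b'"
  by (auto simp: profile_def has_card_def)

text \<open>The infinite clusters split by state into two disjoint families, so the tree count has
  \<open>N = k + l\<close>.\<close>

lemma event_A_profile:
  assumes "\<omega> \<in> event_A"
  obtains k l a b where "\<omega> \<in> profile k l a b" "a + b = k + l + 1"
proof -
  have \<omega>: "\<omega> \<in> Omega" and fin: "finite (inf_cls (same_step \<omega>) (\<lambda>_. True))"
    and ne: "inf_cls (same_step \<omega>) (\<lambda>_. True) \<noteq> {}"
    using assms by (auto simp: event_A_def infinite_clusters_eq)
  define I where "I c = inf_cls (same_step \<omega>) (\<lambda>v. \<omega> v = c)" for c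
  have un: "inf_cls (same_step \<omega>) (\<lambda>_. True) = I 0 \<union> I 1"
    using \<omega> unfolding I_def inf_cls_def Omega_def by fastforce
  have fin': "finite (I 0)" "finite (I 1)" using fin un by auto
  have disj: "I 0 \<inter> I 1 = {}"
  proof (rule ccontr)
    assume "I 0 \<inter> I 1 \<noteq> {}"
    then obtain u v where "cls (same_step \<omega>) u = cls (same_step \<omega>) v" "\<omega> u = 0" "\<omega> v = 1"
      unfolding I_def inf_cls_def by blast
    moreover from this have "u \<in> cls (same_step \<omega>) v" using cls_self by metis
    ultimately show False using cls_same_step_value[of u \<omega> v] by simp
  qed
  have "has_card (inf_cls (same_step \<omega>) (\<lambda>_. True)) (card (I 0) + card (I 1))"
    using fin' disj un by (simp add: has_card_def card_Un_disjoint)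
  moreover have "card (I 0) + card (I 1) > 0"
    using fin' disj un ne by (auto simp: card_gt_0_iff)
  ultimately obtain a b where "has_card (inf_cls (merge_step False \<omega>) (\<lambda>_. True)) a"
    "has_card (inf_cls (merge_step True \<omega>) (\<lambda>_. True)) b" "a + b = card (I 0) + card (I 1) + 1"
    using card_merged_clusters[OF \<omega>] by metis
  then show thesis
    using that[of "card (I 0)" "card (I 1)" a b] \<omega> fin' by (simp add: profile_def has_card_def I_def)
qed

section \<open>Effect of translations on profiles\<close>

definition translate :: "vertex \<Rightarrow> vertex \<Rightarrow> vertex" where
  "translate a v = (fst v + fst a, snd v + snd a)"

lemma bij_translate: "bij (translate a)"
  by (rule o_bij[of "translate (- fst a, - snd a)"]) (auto simp: translate_def fun_eq_iff)

lemma shift_translate: "shift a \<omega> v = \<omega> (translate a v)"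
  by (simp add: shift_def translate_def)

lemma adj_translate: "adj (translate a u) (translate a v) \<longleftrightarrow> adj u v"
  by (simp add: adj_def translate_def)

text \<open>The translation carries the white face beside an edge to a white face, and changes the
  parity of its first coordinate exactly when \<open>fst a\<close> is odd.\<close>

lemma odd_edge_translate:
  assumes "even (fst a + snd a)" "adj u v"
  shows "odd_edge (translate a u) (translate a v) \<longleftrightarrow> (odd_edge u v \<longleftrightarrow> even (fst a))"
  using assms by (cases rule: adj_cases[OF assms(2)]) (auto simp: translate_def odd_edge_def min_def)

lemma shift_Omega:
  assumes "\<omega> \<in> Omega" "even (fst a + snd a)"
  shows "shift a \<omega> \<in> Omega"
proof -
  have "face_word (shift a \<omega>) f = face_word \<omega> (translate a f)" for f
    by (simp add: face_word_def shift_def translate_def Let_def algebra_simps)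
  moreover have "black (translate a f) \<longleftrightarrow> black f" for f
    using assms(2) unfolding black_def translate_def by auto
  ultimately show ?thesis using assms(1) unfolding Omega_def mem_Collect_eq shift_translate by metis
qed

lemma same_step_shift: "same_step (shift a \<omega>) u v \<longleftrightarrow> same_step \<omega> (translate a u) (translate a v)"
  by (simp add: same_step_def shift_translate adj_translate)

lemma merge_step_shift:
  assumes "even (fst a + snd a)"
  shows "merge_step b (shift a \<omega>) u v \<longleftrightarrow>
    merge_step (b \<longleftrightarrow> even (fst a)) \<omega> (translate a u) (translate a v)"
  using odd_edge_translate[OF assms, of u v] by (auto simp: merge_step_def shift_translate adj_translate)

lemma has_card_shift:
  assumes "even (fst a + snd a)"
  shows "has_card (inf_cls (same_step (shift a \<omega>)) (\<lambda>v. shift a \<omega> v = c)) n \<longleftrightarrow>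
      has_card (inf_cls (same_step \<omega>) (\<lambda>v. \<omega> v = c)) n"
    and "has_card (inf_cls (merge_step b (shift a \<omega>)) (\<lambda>_. True)) n \<longleftrightarrow>
      has_card (inf_cls (merge_step (b \<longleftrightarrow> even (fst a)) \<omega>) (\<lambda>_. True)) n"
  by (rule has_card_inf_cls_image[OF bij_translate[of a]],
      simp_all add: same_step_shift shift_translate merge_step_shift[OF assms])+

lemma shift_profile_even:
  assumes "\<omega> \<in> Omega" "even (fst a)" "even (snd a)"
  shows "shift a \<omega> \<in> profile k l c d \<longleftrightarrow> \<omega> \<in> profile k l c d"
  using assms shift_Omega[of \<omega> a] by (simp add: profile_def has_card_shift)

lemma shift_profile_odd:
  assumes "\<omega> \<in> Omega" "odd (fst a)" "odd (snd a)"
  shows "shift a \<omega> \<in> profile k l c d \<longleftrightarrow> \<omega> \<in> profile k l d c"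
  using assms shift_Omega[of \<omega> a] by (auto simp: profile_def has_card_shift)

section \<open>Effect of exchanging the two states\<close>

lemma flip_Omega:
  assumes "\<omega> \<in> Omega"
  shows "flip \<omega> \<in> Omega"
proof -
  let ?words = "{[0,0,0,0], [1,1,1,1], [0,0,1,1], [1,1,0,0], [0,1,1,0], [1,0,0,1]} :: nat list set"
  have "face_word (flip \<omega>) f = map (\<lambda>x. 1 - x) (face_word \<omega> f)" for f
    by (simp add: face_word_def flip_def Let_def)
  moreover have "map (\<lambda>x. 1 - x) w \<in> ?words" if "w \<in> ?words" for w
    using that by auto
  moreover have "flip \<omega> v \<in> {0, 1}" for v
    by (auto simp: flip_def)
  ultimately show ?thesis using assms unfolding Omega_def mem_Collect_eq by metis
qed

lemma flip_eq_iff: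
  assumes "\<omega> \<in> Omega"
  shows "flip \<omega> u = flip \<omega> v \<longleftrightarrow> \<omega> u = \<omega> v" "flip \<omega> u = 0 \<longleftrightarrow> \<omega> u = 1" "flip \<omega> u = 1 \<longleftrightarrow> \<omega> u = 0"
proof -
  have "\<omega> u \<in> {0, 1}" "\<omega> v \<in> {0, 1}" using assms unfolding Omega_def by blast+
  then show "flip \<omega> u = flip \<omega> v \<longleftrightarrow> \<omega> u = \<omega> v" "flip \<omega> u = 0 \<longleftrightarrow> \<omega> u = 1" "flip \<omega> u = 1 \<longleftrightarrow> \<omega> u = 0"
    by (auto simp: flip_def)
qed

text \<open>Which states agree is unchanged, hence so are all classes; only the labels 0 and 1 of
  the clusters trade places.\<close>

lemma flip_profile:
  assumes "\<omega> \<in> Omega"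
  shows "flip \<omega> \<in> profile k l c d \<longleftrightarrow> \<omega> \<in> profile l k c d"
proof -
  have "same_step (flip \<omega>) = same_step \<omega>" "merge_step b (flip \<omega>) = merge_step b \<omega>" for b
    by (simp_all add: fun_eq_iff same_step_def merge_step_def flip_eq_iff[OF assms])
  then show ?thesis
    using assms flip_Omega[OF assms] flip_eq_iff(2,3)[OF assms] unfolding profile_def by auto
qed

section \<open>Measurability\<close>

lemma Omega_subset: "Omega \<subseteq> (\<Pi>\<^sub>E v\<in>UNIV. {0, 1})"
proof
  fix \<omega> assume "\<omega> \<in> Omega"
  then have "\<forall>v. \<omega> v \<in> {0, 1}" unfolding Omega_def by blast
  then show "\<omega> \<in> (\<Pi>\<^sub>E v\<in>UNIV. {0, 1})" by (simp add: PiE_iff)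
qed

lemma space_config_space: "space config_space = Omega"
  unfolding config_space_def space_restrict_space space_PiM space_count_space
  using Omega_subset by (rule Int_absorb2)

lemma measurable_coordinate: "(\<lambda>\<omega>. \<omega> v) \<in> measurable config_space (count_space {0, 1})"
  unfolding config_space_def
  by (intro measurable_restrict_space1 measurable_component_singleton) simp

lemma pred_coordinates:
  "Measurable.pred config_space (\<lambda>\<omega>. \<omega> v = c)" "Measurable.pred config_space (\<lambda>\<omega>. \<omega> u = \<omega> v)"
proof -
  have [measurable]: "(\<lambda>\<omega>. \<omega> v) \<in> measurable config_space (count_space UNIV)" for v
    using measurable_compose[OF measurable_coordinate, of "\<lambda>x. x"] by simp
  show "Measurable.pred config_space (\<lambda>\<omega>. \<omega> v = c)" "Measurable.pred config_space (\<lambda>\<omega>. \<omega> u = \<omega> v)"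
    by measurable
qed

lemma sets_profile: "profile k l a b \<in> sets config_space"
proof -
  note [measurable] = pred_coordinates
  have [measurable]: "Measurable.pred config_space (\<lambda>\<omega>. same_step \<omega> u v)"
    "Measurable.pred config_space (\<lambda>\<omega>. merge_step c \<omega> u v)" for u v c
    unfolding same_step_def merge_step_def by measurable
  have [measurable]:
    "Measurable.pred config_space (\<lambda>\<omega>. has_card (inf_cls (same_step \<omega>) (\<lambda>v. \<omega> v = c)) n)"
    "Measurable.pred config_space (\<lambda>\<omega>. has_card (inf_cls (merge_step d \<omega>) (\<lambda>_. True)) n)" for c d n
    by (rule pred_has_card_inf_cls; simp add: symp_same_step symp_merge_step)+
  show ?thesis unfolding profile_def space_config_space[symmetric] by measurable
qed

text \<open>The form of \<open>F\<close> covers a shift, where \<open>\<phi>\<close> is the identity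
  and \<open>p\<close> a translation, as well as \<open>flip\<close>, where \<open>p\<close> is the
  identity.\<close>

lemma measurable_config_space:
  assumes "\<And>\<omega>. \<omega> \<in> Omega \<Longrightarrow> F \<omega> \<in> Omega" "\<And>\<omega> v. F \<omega> v = \<phi> (\<omega> (p v))" "\<phi> \<in> {0, 1} \<rightarrow> {0, 1}"
  shows "F \<in> measurable config_space config_space"
proof -
  have "F \<in> measurable config_space (PiM UNIV (\<lambda>_. count_space {0, 1}))"
  proof (rule measurable_PiM_single')
    show "(\<lambda>\<omega>. F \<omega> v) \<in> measurable config_space (count_space {0, 1})" for v
      unfolding assms(2) by (rule measurable_compose[OF measurable_coordinate]) (use assms(3) in simp)
    show "F \<in> space config_space \<rightarrow> (\<Pi>\<^sub>E v\<in>UNIV. space (count_space {0, 1}))"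
      using assms(1) Omega_subset unfolding space_config_space space_count_space by blast
  qed
  then show ?thesis
    using assms(1) space_config_space unfolding config_space_def
    by (intro measurable_restrict_space2) auto
qed

theorem theorem1p1:
  fixes M :: "config measure"
  assumes "prob_space M"
    and "sets M = sets config_space" and "space M = space config_space"
    and A1: "\<forall>a \<in> diag_lattice. distr M M (shift a) = M"
    and A2: "\<forall>E \<in> sets M. (\<forall>a \<in> even_lattice. shift a -` E \<inter> space M = E)
               \<longrightarrow> measure M E = 0 \<or> measure M E = 1"
    and A3: "distr M M flip = M"
  shows "AE \<omega> in M. \<omega> \<notin> event_A"
proof -
  interpret prob_space M by fact
  have space: "space M = Omega" using assms(3) by (simp add: space_config_space)
  have sets: "profile k l c d \<in> sets M" for k l c d using sets_profile assms(2) by simp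
  have meas_M: "measurable M M = measurable config_space config_space"
    using assms(2) by (rule measurable_cong_sets) fact
  have "shift (1, 1) \<in> measurable M M" unfolding meas_M
    by (rule measurable_config_space[of _ "\<lambda>x. x" "translate (1, 1)"]) (auto simp: shift_Omega shift_translate)
  moreover have "(1, 1) \<in> diag_lattice"
    unfolding diag_lattice_def by (rule CollectI, rule exI[of _ 1], rule exI[of _ 0]) simp
  then have "distr M M (shift (1, 1)) = M" using A1 by blast
  ultimately have "prob (shift (1, 1) -` E \<inter> space M) = prob E" if "E \<in> sets M" for E
    using measure_distr[of "shift (1, 1)" M M E] that by metis
  moreover have "shift (1, 1) -` profile k l c d \<inter> space M = profile k l d c" for k l c d
    unfolding space by (intro vimage_Omega shift_profile_odd profile_Omega) simp_all
  ultimately have prob_shift: "prob (profile k l c d) = prob (profile k l d c)" for k l c d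
    using sets by metis
  have "flip \<in> measurable M M" unfolding meas_M
    by (rule measurable_config_space[of _ "\<lambda>x. 1 - x" "\<lambda>v. v"], rule flip_Omega) (auto simp: flip_def)
  then have "prob (flip -` E \<inter> space M) = prob E" if "E \<in> sets M" for E
    using measure_distr[of flip M M E] that unfolding A3 by metis
  moreover have "flip -` profile k l c d \<inter> space M = profile l k c d" for k l c d
    unfolding space by (intro vimage_Omega flip_profile profile_Omega)
  ultimately have prob_flip: "prob (profile k l c d) = prob (profile l k c d)" for k l c d
    using sets by metis
  have zero_one: "prob (profile k l c d) = 0 \<or> prob (profile k l c d) = 1" for k l c d
  proof (rule A2[rule_format, OF sets])
    fix a assume "a \<in> even_lattice"
    then have "even (fst a)" "even (snd a)" by (auto simp: even_lattice_def)
    then show "shift a -` profile k l c d \<inter> space M = profile k l c d"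
      unfolding space by (intro vimage_Omega shift_profile_even profile_Omega)
  qed
  have meet: "A \<inter> B \<noteq> {}" if "A \<in> sets M" "B \<in> sets M" "prob A = 1" "prob B = 1" for A B
  proof
    assume "A \<inter> B = {}"
    then have "prob (A \<union> B) = 2" using finite_measure_Union[OF that(1,2)] that by simp
    then show False using prob_le_1[of "A \<union> B"] by simp
  qed
  have null: "prob (profile k l c d) = 0" if "c + d = k + l + 1" for k l c d
  proof (rule ccontr)
    assume "\<not> ?thesis"
    then have 1: "prob (profile k l c d) = 1" using zero_one by blast
    \<comment> \<open>The images of the profile under \<open>flip\<close> and under the shift by
      \<open>(1, 1)\<close> also have probability 1, so they meet it. Uniqueness of the counts
      forces \<open>k = l\<close> and \<open>c = d\<close>, and then
      \<open>2 * c = 2 * k + 1\<close> is impossible.\<close>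
    then have "profile k l c d \<inter> profile l k c d \<noteq> {}" "profile k l c d \<inter> profile k l d c \<noteq> {}"
      using meet[OF sets sets] prob_flip[of k l c d] prob_shift[of k l c d] by auto
    then have "k = l" "c = d" using profile_unique by blast+
    then show False using that by presburger
  qed
  have "AE \<omega> in M. c + d = k + l + 1 \<longrightarrow> \<omega> \<notin> profile k l c d" for k l c d
  proof (cases "c + d = k + l + 1")
    case True
    then have "profile k l c d \<in> null_sets M"
      using null sets by (simp add: null_sets_def emeasure_eq_measure)
    then show ?thesis using True AE_not_in by auto
  qed simp
  \<comment> \<open>Only countably many quadruples occur, so their null sets can be discarded
    together.\<close>
  then have "AE \<omega> in M. \<forall>k l c d. c + d = k + l + 1 \<longrightarrow> \<omega> \<notin> profile k l c d"
    by (simp add: AE_all_countable)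
  then show ?thesis by eventually_elim (use event_A_profile in metis)
qed

end
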